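(* The functors $\mathrm{K}:\mathsf{hBDL}\to\mathsf{KhBDL}^{\mathrm{CK}}$ and $\mathrm{C}:\mathsf{KhBDL}^{\mathrm{CK}}\to\mathsf{hBDL}$ establish a categorical equivalence between $\mathsf{hBDL}$ and $\mathsf{KhBDL}^{\mathrm{CK}}$, with natural isomorphisms $\alpha:\mathrm{Id}\Rightarrow \mathrm{C}\circ\mathrm{K}$ and $\beta:\mathrm{Id}\Rightarrow\mathrm{K}\circ\mathrm{C}$.
   Context: A hemi-implicative lattice is an algebra $(H,\wedge,\vee,\to,0,1)$ such that $(H,\wedge,\vee,0,1)$ is a bounded distributive lattice, $a\to a=1$ for all $a$, and for all $a,b,d$, if $a\le b\to d$ then $a\wedge b\le d$. $\mathsf{hBDL}$ is the category of hemi-implicative lattices and algebra homomorphisms. A centered Kleene algebra is an algebra $(T,\wedge,\vee,\sim,c,0,1)$ such that $(T,\wedge,\vee,0,1)$ is a bounded distributive lattice, $\sim\sim x=x$, $\sim(x\vee y)=\sim x\wedge\sim y$, $x\wedge\sim x\le y\vee\sim y$ for all $x,y$, and $c=\sim c$. $\mathsf{KhBDL}$ is the category whose objects are the algebras $(T,\wedge,\vee,\to,\sim,c,0,1)$ such that $(T,\wedge,\vee,\sim,c,0,1)$ is a centered Kleene algebra and for all $x,y\in T$: (K1) $c\le x\to(y\vee c)$; (K2) $x\wedge((x\vee c)\to(y\vee c))\le y\vee c$; (K3) $x\to x=1$; (K4) $(x\to y)\wedge c=(\sim x\wedge c)\vee(y\wedge c)$; (K5) $(x\to\sim y)\vee c=((x\vee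 c)\to(\sim y\vee c))\wedge((y\vee c)\to(\sim x\vee c))$. Its morphisms are algebra homomorphisms. Condition (CK) for $T$: for all $x,y\ge c$ with $x\wedge y=c$ there is $z\in T$ with $z\vee c=x$ and $\sim z\vee c=y$. $\mathsf{KhBDL}^{\mathrm{CK}}$ is the full subcategory of $\mathsf{KhBDL}$ of objects satisfying (CK). For $H\in\mathsf{hBDL}$, $\mathrm{K}(H)=\{(a,b)\in H\times H:a\wedge b=0\}$ with $(a,b)\vee(d,e)=(a\vee d,b\wedge e)$, $(a,b)\wedge(d,e)=(a\wedge d,b\vee e)$, $\sim(a,b)=(b,a)$, $0=(0,1)$, $1=(1,0)$, $c=(0,0)$, $(a,b)\to(d,e)=((a\to d)\wedge(e\to b),a\wedge e)$; for a morphism $f$, $\mathrm{K}(f)(a,b)=(f(a),f(b))$. For $T\in\mathsf{KhBDL}$, $\mathrm{C}(T)=\{x\in T:x\ge c\}$ with restricted operations $\wedge,\vee,\to$, bottom $c$ and top $1$; $\mathrm{C}(g)$ is the restriction of $g$. The maps are $\alpha_H:H\to\mathrm{C}(\mathrm{K}(H))$, $\alpha_H(a)=(a,0)$, and $\beta_T:T\to\mathrm{K}(\mathrm{C}(T))$, $\beta_T(x)=(x\vee c,\sim x\vee c)$. *)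

theory Defs
  imports "HOL-Library.FuncSet"
begin

text \<open>\<^term>\<open>Comp C g f\<close> is the composite g after f; it is only meaningful for composable arrows.\<close>

record ('o, 'm) cat =
  Obj :: "'o set"
  Arr :: "'m set"
  Dom :: "'m \<Rightarrow> 'o"
  Cod :: "'m \<Rightarrow> 'o"
  Id :: "'o \<Rightarrow> 'm"
  Comp :: "'m \<Rightarrow> 'm \<Rightarrow> 'm"

definition Hom :: "('o, 'm) cat \<Rightarrow> 'o \<Rightarrow> 'o \<Rightarrow> 'm set" where
  "Hom C X Y = {f \<in> Arr C. Dom C f = X \<and> Cod C f = Y}"

locale category =
  fixes C :: "('o, 'm) cat"
  assumes Dom_in: "f \<in> Arr C \<Longrightarrow> Dom C f \<in> Obj C"
    and Cod_in: "f \<in> Arr C \<Longrightarrow> Cod C f \<in> Obj C"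
    and Id_in: "X \<in> Obj C \<Longrightarrow> Id C X \<in> Hom C X X"
    and Comp_in: "\<lbrakk>f \<in> Hom C X Y; g \<in> Hom C Y Z\<rbrakk> \<Longrightarrow> Comp C g f \<in> Hom C X Z"
    and Id_left: "f \<in> Hom C X Y \<Longrightarrow> Comp C (Id C Y) f = f"
    and Id_right: "f \<in> Hom C X Y \<Longrightarrow> Comp C f (Id C X) = f"
    and Comp_assoc: "\<lbrakk>f \<in> Hom C W X; g \<in> Hom C X Y; h \<in> Hom C Y Z\<rbrakk>
      \<Longrightarrow> Comp C h (Comp C g f) = Comp C (Comp C h g) f"

definition full_subcategory :: "('o, 'm) cat \<Rightarrow> ('o \<Rightarrow> bool) \<Rightarrow> ('o, 'm) cat" where
  "full_subcategory C P =
     C\<lparr>Obj := {X \<in> Obj C. P X}, Arr := {f \<in> Arr C. P (Dom C f) \<and> P (Cod C f)}\<rparr>"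

definition is_iso :: "('o, 'm) cat \<Rightarrow> 'm \<Rightarrow> bool" where
  "is_iso C f \<longleftrightarrow> f \<in> Arr C \<and>
     (\<exists>g \<in> Hom C (Cod C f) (Dom C f).
        Comp C g f = Id C (Dom C f) \<and> Comp C f g = Id C (Cod C f))"

record ('o1, 'm1, 'o2, 'm2) functr =
  on_obj :: "'o1 \<Rightarrow> 'o2"
  on_arr :: "'m1 \<Rightarrow> 'm2"

definition id_functor :: "('o, 'm, 'o, 'm) functr" where
  "id_functor = \<lparr>on_obj = (\<lambda>X. X), on_arr = (\<lambda>f. f)\<rparr>"

definition comp_functor ::
  "('o2, 'm2, 'o3, 'm3) functr \<Rightarrow> ('o1, 'm1, 'o2, 'm2) functr \<Rightarrow> ('o1, 'm1, 'o3, 'm3) functr" where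
  "comp_functor G F = \<lparr>on_obj = on_obj G \<circ> on_obj F, on_arr = on_arr G \<circ> on_arr F\<rparr>"

locale is_functor = A: category A + B: category B
  for A :: "('o1, 'm1) cat" and B :: "('o2, 'm2) cat" +
  fixes F :: "('o1, 'm1, 'o2, 'm2) functr"
  assumes on_obj_in: "X \<in> Obj A \<Longrightarrow> on_obj F X \<in> Obj B"
    and on_arr_in: "f \<in> Hom A X Y \<Longrightarrow> on_arr F f \<in> Hom B (on_obj F X) (on_obj F Y)"
    and on_arr_Id: "X \<in> Obj A \<Longrightarrow> on_arr F (Id A X) = Id B (on_obj F X)"
    and on_arr_Comp: "\<lbrakk>f \<in> Hom A X Y; g \<in> Hom A Y Z\<rbrakk>
      \<Longrightarrow> on_arr F (Comp A g f) = Comp B (on_arr F g) (on_arr F f)"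

locale natural_transformation = F: is_functor A B F + G: is_functor A B G
  for A :: "('o1, 'm1) cat" and B :: "('o2, 'm2) cat" and F G +
  fixes \<eta> :: "'o1 \<Rightarrow> 'm2"
  assumes component_in: "X \<in> Obj A \<Longrightarrow> \<eta> X \<in> Hom B (on_obj F X) (on_obj G X)"
    and naturality: "f \<in> Hom A X Y \<Longrightarrow> Comp B (\<eta> Y) (on_arr F f) = Comp B (on_arr G f) (\<eta> X)"

locale natural_isomorphism = natural_transformation +
  assumes component_iso: "X \<in> Obj A \<Longrightarrow> is_iso B (\<eta> X)"

locale categorical_equivalence =
  F: is_functor A B F + G: is_functor B A G +
  unit: natural_isomorphism A A id_functor "comp_functor G F" \<eta> +
  counit: natural_isomorphism B B id_functor "comp_functor F G" \<epsilon>
  for A :: "('o1, 'm1) cat" and B :: "('o2, 'm2) cat" and F G \<eta> \<epsilon>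

text \<open>As in HOL-Algebra, an algebra is a record with an explicit carrier set, and the values
  of its operations outside the carrier are irrelevant.\<close>

record 'u bdl =
  carrier :: "'u set"
  meet :: "'u \<Rightarrow> 'u \<Rightarrow> 'u" (infixl "\<sqinter>\<index>" 70)
  join :: "'u \<Rightarrow> 'u \<Rightarrow> 'u" (infixl "\<squnion>\<index>" 65)
  zero :: "'u" ("\<zero>\<index>")
  one :: "'u" ("\<one>\<index>")

record 'u hil = "'u bdl" +
  imp :: "'u \<Rightarrow> 'u \<Rightarrow> 'u" (infixr "\<leadsto>\<index>" 60)

record 'u khil = "'u hil" +
  neg :: "'u \<Rightarrow> 'u" ("\<sim>\<index> _" [81] 80)
  center :: "'u" ("\<cc>\<index>")

definition leq :: "('u, 'z) bdl_scheme \<Rightarrow> 'u \<Rightarrow> 'u \<Rightarrow> bool" (infixl "\<sqsubseteq>\<index>" 50) where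
  "x \<sqsubseteq>\<^bsub>L\<^esub> y \<longleftrightarrow> x \<sqinter>\<^bsub>L\<^esub> y = x"

locale bounded_distributive_lattice =
  fixes L :: "('u, 'z) bdl_scheme" (structure)
  assumes meet_closed: "\<lbrakk>x \<in> carrier L; y \<in> carrier L\<rbrakk> \<Longrightarrow> x \<sqinter> y \<in> carrier L"
    and join_closed: "\<lbrakk>x \<in> carrier L; y \<in> carrier L\<rbrakk> \<Longrightarrow> x \<squnion> y \<in> carrier L"
    and zero_closed: "\<zero> \<in> carrier L"
    and one_closed: "\<one> \<in> carrier L"
    and meet_comm: "\<lbrakk>x \<in> carrier L; y \<in> carrier L\<rbrakk> \<Longrightarrow> x \<sqinter> y = y \<sqinter> x"
    and join_comm: "\<lbrakk>x \<in> carrier L; y \<in> carrier L\<rbrakk> \<Longrightarrow> x \<squnion> y = y \<squnion> x"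
    and meet_assoc: "\<lbrakk>x \<in> carrier L; y \<in> carrier L; z \<in> carrier L\<rbrakk>
      \<Longrightarrow> (x \<sqinter> y) \<sqinter> z = x \<sqinter> (y \<sqinter> z)"
    and join_assoc: "\<lbrakk>x \<in> carrier L; y \<in> carrier L; z \<in> carrier L\<rbrakk>
      \<Longrightarrow> (x \<squnion> y) \<squnion> z = x \<squnion> (y \<squnion> z)"
    and meet_absorb: "\<lbrakk>x \<in> carrier L; y \<in> carrier L\<rbrakk> \<Longrightarrow> x \<sqinter> (x \<squnion> y) = x"
    and join_absorb: "\<lbrakk>x \<in> carrier L; y \<in> carrier L\<rbrakk> \<Longrightarrow> x \<squnion> (x \<sqinter> y) = x"
    and meet_distrib: "\<lbrakk>x \<in> carrier L; y \<in> carrier L; z \<in> carrier L\<rbrakk>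
      \<Longrightarrow> x \<sqinter> (y \<squnion> z) = (x \<sqinter> y) \<squnion> (x \<sqinter> z)"
    and zero_least: "x \<in> carrier L \<Longrightarrow> \<zero> \<sqsubseteq> x"
    and one_greatest: "x \<in> carrier L \<Longrightarrow> x \<sqsubseteq> \<one>"

locale hemi_implicative_lattice = bounded_distributive_lattice H
  for H :: "('u, 'z) hil_scheme" (structure) +
  assumes imp_closed: "\<lbrakk>x \<in> carrier H; y \<in> carrier H\<rbrakk> \<Longrightarrow> x \<leadsto> y \<in> carrier H"
    and imp_refl: "a \<in> carrier H \<Longrightarrow> a \<leadsto> a = \<one>"
    and imp_meet: "\<lbrakk>a \<in> carrier H; b \<in> carrier H; d \<in> carrier H; a \<sqsubseteq> b \<leadsto> d\<rbrakk>
      \<Longrightarrow> a \<sqinter> b \<sqsubseteq> d"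

locale centered_kleene_algebra = bounded_distributive_lattice T
  for T :: "('u, 'z) khil_scheme" (structure) +
  assumes neg_closed: "x \<in> carrier T \<Longrightarrow> \<sim> x \<in> carrier T"
    and center_closed: "\<cc> \<in> carrier T"
    and neg_neg: "x \<in> carrier T \<Longrightarrow> \<sim> (\<sim> x) = x"
    and neg_join: "\<lbrakk>x \<in> carrier T; y \<in> carrier T\<rbrakk> \<Longrightarrow> \<sim> (x \<squnion> y) = (\<sim> x) \<sqinter> (\<sim> y)"
    and kleene: "\<lbrakk>x \<in> carrier T; y \<in> carrier T\<rbrakk> \<Longrightarrow> x \<sqinter> (\<sim> x) \<sqsubseteq> y \<squnion> (\<sim> y)"
    and neg_center: "\<cc> = \<sim> \<cc>"

locale khbdl_algebra = centered_kleene_algebra T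
  for T :: "('u, 'z) khil_scheme" (structure) +
  assumes imp_closed: "\<lbrakk>x \<in> carrier T; y \<in> carrier T\<rbrakk> \<Longrightarrow> x \<leadsto> y \<in> carrier T"
    and K1: "\<lbrakk>x \<in> carrier T; y \<in> carrier T\<rbrakk> \<Longrightarrow> \<cc> \<sqsubseteq> x \<leadsto> (y \<squnion> \<cc>)"
    and K2: "\<lbrakk>x \<in> carrier T; y \<in> carrier T\<rbrakk>
      \<Longrightarrow> x \<sqinter> ((x \<squnion> \<cc>) \<leadsto> (y \<squnion> \<cc>)) \<sqsubseteq> y \<squnion> \<cc>"
    and K3: "x \<in> carrier T \<Longrightarrow> x \<leadsto> x = \<one>"
    and K4: "\<lbrakk>x \<in> carrier T; y \<in> carrier T\<rbrakk>
      \<Longrightarrow> (x \<leadsto> y) \<sqinter> \<cc> = ((\<sim> x) \<sqinter> \<cc>) \<squnion> (y \<sqinter> \<cc>)"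
    and K5: "\<lbrakk>x \<in> carrier T; y \<in> carrier T\<rbrakk>
      \<Longrightarrow> (x \<leadsto> (\<sim> y)) \<squnion> \<cc> =
          ((x \<squnion> \<cc>) \<leadsto> ((\<sim> y) \<squnion> \<cc>)) \<sqinter> ((y \<squnion> \<cc>) \<leadsto> ((\<sim> x) \<squnion> \<cc>))"

definition CK :: "('u, 'z) khil_scheme \<Rightarrow> bool" where
  "CK T \<longleftrightarrow>
     (\<forall>x \<in> carrier T. \<forall>y \<in> carrier T.
        \<cc>\<^bsub>T\<^esub> \<sqsubseteq>\<^bsub>T\<^esub> x \<and> \<cc>\<^bsub>T\<^esub> \<sqsubseteq>\<^bsub>T\<^esub> y \<and> x \<sqinter>\<^bsub>T\<^esub> y = \<cc>\<^bsub>T\<^esub> \<longrightarrow>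
        (\<exists>z \<in> carrier T. z \<squnion>\<^bsub>T\<^esub> \<cc>\<^bsub>T\<^esub> = x \<and> (\<sim>\<^bsub>T\<^esub> z) \<squnion>\<^bsub>T\<^esub> \<cc>\<^bsub>T\<^esub> = y))"

text \<open>A homomorphism is an extensional function (undefined outside the carrier of its source),
  so that equality of arrows is equality of maps on the carrier.\<close>

definition bdl_hom :: "('u, 'y) bdl_scheme \<Rightarrow> ('v, 'z) bdl_scheme \<Rightarrow> ('u \<Rightarrow> 'v) set" where
  "bdl_hom A B = {h \<in> carrier A \<rightarrow>\<^sub>E carrier B.
     (\<forall>x \<in> carrier A. \<forall>y \<in> carrier A. h (x \<sqinter>\<^bsub>A\<^esub> y) = h x \<sqinter>\<^bsub>B\<^esub> h y) \<and>
     (\<forall>x \<in> carrier A. \<forall>y \<in> carrier A. h (x \<squnion>\<^bsub>A\<^esub> y) = h x \<squnion>\<^bsub>B\<^esub> h y) \<and>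
     h \<zero>\<^bsub>A\<^esub> = \<zero>\<^bsub>B\<^esub> \<and> h \<one>\<^bsub>A\<^esub> = \<one>\<^bsub>B\<^esub>}"

definition hil_hom :: "('u, 'y) hil_scheme \<Rightarrow> ('v, 'z) hil_scheme \<Rightarrow> ('u \<Rightarrow> 'v) set" where
  "hil_hom A B = {h \<in> bdl_hom A B.
     \<forall>x \<in> carrier A. \<forall>y \<in> carrier A. h (x \<leadsto>\<^bsub>A\<^esub> y) = h x \<leadsto>\<^bsub>B\<^esub> h y}"

definition khil_hom :: "('u, 'y) khil_scheme \<Rightarrow> ('v, 'z) khil_scheme \<Rightarrow> ('u \<Rightarrow> 'v) set" where
  "khil_hom A B = {h \<in> hil_hom A B.
     (\<forall>x \<in> carrier A. h (\<sim>\<^bsub>A\<^esub> x) = \<sim>\<^bsub>B\<^esub> (h x)) \<and> h \<cc>\<^bsub>A\<^esub> = \<cc>\<^bsub>B\<^esub>}"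

record ('o, 'u) arrow =
  source :: 'o
  target :: 'o
  map_of_arrow :: "'u \<Rightarrow> 'u"

definition algebra_category ::
  "('u, 'z) bdl_scheme set \<Rightarrow> (('u, 'z) bdl_scheme \<Rightarrow> ('u, 'z) bdl_scheme \<Rightarrow> ('u \<Rightarrow> 'u) set)
    \<Rightarrow> (('u, 'z) bdl_scheme, (('u, 'z) bdl_scheme, 'u) arrow) cat" where
  "algebra_category Ob H =
    \<lparr>Obj = Ob,
     Arr = {f. source f \<in> Ob \<and> target f \<in> Ob \<and> map_of_arrow f \<in> H (source f) (target f)},
     Dom = source,
     Cod = target,
     Id = (\<lambda>A. \<lparr>source = A, target = A, map_of_arrow = (\<lambda>x \<in> carrier A. x)\<rparr>),
     Comp = (\<lambda>g f. \<lparr>source = source f, target = target g,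
       map_of_arrow = compose (carrier (source f)) (map_of_arrow g) (map_of_arrow f)\<rparr>)\<rparr>"

definition hBDL :: "('u hil, ('u hil, 'u) arrow) cat" where
  "hBDL = algebra_category {H. hemi_implicative_lattice H} hil_hom"

definition KhBDL :: "('u khil, ('u khil, 'u) arrow) cat" where
  "KhBDL = algebra_category {T. khbdl_algebra T} khil_hom"

definition KhBDL_CK :: "('u khil, ('u khil, 'u) arrow) cat" where
  "KhBDL_CK = full_subcategory KhBDL CK"

text \<open>K passes from an algebra on a set to an algebra on pairs of its elements. For K and C to be
  functors between two fixed categories, the elements are drawn from a type closed under pairing.
  Every algebra over a type \<open>'a\<close> has an isomorphic copy (via \<open>Atom\<close>) over \<open>'a univ\<close>.\<close>

datatype 'a univ = Atom 'a | Pair (pfst: "'a univ") (psnd: "'a univ")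

definition K_obj :: "'a univ hil \<Rightarrow> 'a univ khil" where
  "K_obj H =
    \<lparr>carrier = {Pair a b | a b. a \<in> carrier H \<and> b \<in> carrier H \<and> a \<sqinter>\<^bsub>H\<^esub> b = \<zero>\<^bsub>H\<^esub>},
     meet = (\<lambda>x y. Pair (pfst x \<sqinter>\<^bsub>H\<^esub> pfst y) (psnd x \<squnion>\<^bsub>H\<^esub> psnd y)),
     join = (\<lambda>x y. Pair (pfst x \<squnion>\<^bsub>H\<^esub> pfst y) (psnd x \<sqinter>\<^bsub>H\<^esub> psnd y)),
     zero = Pair \<zero>\<^bsub>H\<^esub> \<one>\<^bsub>H\<^esub>,
     one = Pair \<one>\<^bsub>H\<^esub> \<zero>\<^bsub>H\<^esub>,
     imp = (\<lambda>x y. Pair ((pfst x \<leadsto>\<^bsub>H\<^esub> pfst y) \<sqinter>\<^bsub>H\<^esub> (psnd y \<leadsto>\<^bsub>H\<^esub> psnd x)) (pfst x \<sqinter>\<^bsub>H\<^esub> psnd y)),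
     neg = (\<lambda>x. Pair (psnd x) (pfst x)),
     center = Pair \<zero>\<^bsub>H\<^esub> \<zero>\<^bsub>H\<^esub>\<rparr>"

definition K_arr :: "('a univ hil, 'a univ) arrow \<Rightarrow> ('a univ khil, 'a univ) arrow" where
  "K_arr f =
    \<lparr>source = K_obj (source f), target = K_obj (target f),
     map_of_arrow = (\<lambda>x \<in> carrier (K_obj (source f)).
       Pair (map_of_arrow f (pfst x)) (map_of_arrow f (psnd x)))\<rparr>"

definition K_functor ::
  "('a univ hil, ('a univ hil, 'a univ) arrow, 'a univ khil, ('a univ khil, 'a univ) arrow) functr" where
  "K_functor = \<lparr>on_obj = K_obj, on_arr = K_arr\<rparr>"

definition C_obj :: "'u khil \<Rightarrow> 'u hil" where
  "C_obj T =
    \<lparr>carrier = {x \<in> carrier T. \<cc>\<^bsub>T\<^esub> \<sqsubseteq>\<^bsub>T\<^esub> x},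
     meet = meet T, join = join T, zero = \<cc>\<^bsub>T\<^esub>, one = \<one>\<^bsub>T\<^esub>, imp = imp T\<rparr>"

definition C_arr :: "('u khil, 'u) arrow \<Rightarrow> ('u hil, 'u) arrow" where
  "C_arr g =
    \<lparr>source = C_obj (source g), target = C_obj (target g),
     map_of_arrow = restrict (map_of_arrow g) (carrier (C_obj (source g)))\<rparr>"

definition C_functor :: "('u khil, ('u khil, 'u) arrow, 'u hil, ('u hil, 'u) arrow) functr" where
  "C_functor = \<lparr>on_obj = C_obj, on_arr = C_arr\<rparr>"

definition alpha :: "'a univ hil \<Rightarrow> ('a univ hil, 'a univ) arrow" where
  "alpha H =
    \<lparr>source = H, target = C_obj (K_obj H),
     map_of_arrow = (\<lambda>a \<in> carrier H. Pair a \<zero>\<^bsub>H\<^esub>)\<rparr>"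

definition beta :: "'a univ khil \<Rightarrow> ('a univ khil, 'a univ) arrow" where
  "beta T =
    \<lparr>source = T, target = K_obj (C_obj T),
     map_of_arrow = (\<lambda>x \<in> carrier T. Pair (x \<squnion>\<^bsub>T\<^esub> \<cc>\<^bsub>T\<^esub>) ((\<sim>\<^bsub>T\<^esub> x) \<squnion>\<^bsub>T\<^esub> \<cc>\<^bsub>T\<^esub>))\<rparr>"

end

theory Submission
  imports Defs
begin

text \<open>The homomorphism property of \<open>\<beta>\<close> splits between the two components of
  \<open>x \<leadsto> y\<close>. The first component is (K5) with \<open>\<sim> y\<close> in place of \<open>y\<close>. The second is the negation of (K4),
  since \<open>(\<sim> z) \<squnion> \<cc> = \<sim> (z \<sqinter> \<cc>)\<close>. The same identity shows that \<open>\<beta> x\<close> determines both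
  \<open>x \<squnion> \<cc>\<close> and \<open>x \<sqinter> \<cc>\<close>, and hence \<open>x\<close> by distributivity, so \<open>\<beta>\<close> is injective; surjectivity is exactly (CK).
  In the opposite direction, (K1) makes \<open>C(T)\<close> closed under implication and (K2) gives modus ponens in it, while
  modus ponens in \<open>H\<close> is what keeps \<open>K(H)\<close> closed under implication. Both \<open>\<alpha>\<close> and \<open>\<beta>\<close>
  are bijective homomorphisms of algebras, and therefore isomorphisms.\<close>

section \<open>Categories of algebras\<close>

lemma algebra_category_simps [simp]:
  "Obj (algebra_category Ob H) = Ob"
  "f \<in> Arr (algebra_category Ob H) \<longleftrightarrow>
    source f \<in> Ob \<and> target f \<in> Ob \<and> map_of_arrow f \<in> H (source f) (target f)"
  "Dom (algebra_category Ob H) = source"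
  "Cod (algebra_category Ob H) = target"
  "Id (algebra_category Ob H) A = \<lparr>source = A, target = A, map_of_arrow = (\<lambda>x \<in> carrier A. x)\<rparr>"
  "Comp (algebra_category Ob H) g f = \<lparr>source = source f, target = target g,
     map_of_arrow = compose (carrier (source f)) (map_of_arrow g) (map_of_arrow f)\<rparr>"
  by (simp_all add: algebra_category_def)

lemma Hom_algebra_category [simp]:
  "f \<in> Hom (algebra_category Ob H) A B \<longleftrightarrow>
    source f = A \<and> target f = B \<and> A \<in> Ob \<and> B \<in> Ob \<and> map_of_arrow f \<in> H A B"
  by (auto simp: Hom_def)

text \<open>Associativity and the unit laws are inherited from functions, so only closure under
  identities and composites has to be checked for the homomorphism sets. The extensional function
  space in the first hypothesis turns the unit laws into equalities of arrows.\<close>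

lemma category_algebra_category:
  assumes "\<And>A B. H A B \<subseteq> carrier A \<rightarrow>\<^sub>E carrier B"
    and "\<And>A. A \<in> Ob \<Longrightarrow> (\<lambda>x \<in> carrier A. x) \<in> H A A"
    and "\<And>A B D f g. \<lbrakk>A \<in> Ob; f \<in> H A B; g \<in> H B D\<rbrakk> \<Longrightarrow> compose (carrier A) g f \<in> H A D"
  shows "category (algebra_category Ob H)"
proof
  fix f X Y assume f: "f \<in> Hom (algebra_category Ob H) X Y"
  then have map: "map_of_arrow f \<in> carrier X \<rightarrow>\<^sub>E carrier Y"
    using assms(1) by auto
  show "Comp (algebra_category Ob H) (Id (algebra_category Ob H) Y) f = f"
    using f map by (auto intro!: arrow.equality simp: compose_def fun_eq_iff PiE_iff extensional_def)
  show "Comp (algebra_category Ob H) f (Id (algebra_category Ob H) X) = f"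
    using f map by (auto intro!: arrow.equality simp: compose_def fun_eq_iff PiE_iff extensional_def)
next
  fix f g h W X Y Z
  assume *: "f \<in> Hom (algebra_category Ob H) W X" "g \<in> Hom (algebra_category Ob H) X Y"
    "h \<in> Hom (algebra_category Ob H) Y Z"
  \<comment> \<open>The composite of \<open>h\<close> and \<open>g\<close> is restricted to
    \<open>carrier X\<close>, so it can be evaluated at a value of \<open>f\<close> only if that
    value lies there.\<close>
  then have "map_of_arrow f \<in> carrier W \<rightarrow>\<^sub>E carrier X"
    using assms(1) by auto
  then show "Comp (algebra_category Ob H) h (Comp (algebra_category Ob H) g f) =
      Comp (algebra_category Ob H) (Comp (algebra_category Ob H) h g) f"
    using * by (auto simp: compose_def fun_eq_iff)
qed (use assms in auto)

text \<open>The inverse arrow is the set-theoretic inverse, cut off to \<open>carrier B\<close> to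
  make it extensional. Bijectivity gives the two identities, and the last hypothesis makes it an
  arrow.\<close>

lemma is_iso_algebra_category:
  assumes f: "f \<in> Hom (algebra_category Ob H) A B"
    and bij: "bij_betw (map_of_arrow f) (carrier A) (carrier B)"
    and inv: "(\<lambda>y \<in> carrier B. inv_into (carrier A) (map_of_arrow f) y) \<in> H B A"
  shows "is_iso (algebra_category Ob H) f"
proof -
  let ?g = "\<lparr>source = B, target = A,
    map_of_arrow = (\<lambda>y \<in> carrier B. inv_into (carrier A) (map_of_arrow f) y)\<rparr>"
  have "?g \<in> Hom (algebra_category Ob H) B A"
    using f inv by auto
  moreover have "Comp (algebra_category Ob H) ?g f = Id (algebra_category Ob H) A"
    using f bij by (auto simp: compose_def fun_eq_iff bij_betw_def)
  moreover have "Comp (algebra_category Ob H) f ?g = Id (algebra_category Ob H) B"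
    using f bij by (auto simp: compose_def fun_eq_iff bij_betw_def f_inv_into_f)
  ultimately show ?thesis
    using f unfolding is_iso_def by (auto intro!: bexI[of _ ?g])
qed

section \<open>Identities, composites and inverses of homomorphisms\<close>

context bounded_distributive_lattice
begin

lemmas closed [simp] = meet_closed join_closed zero_closed one_closed

lemma id_bdl_hom: "(\<lambda>x \<in> carrier L. x) \<in> bdl_hom L L"
  by (simp add: bdl_hom_def)

end

lemma compose_bdl_hom:
  "\<lbrakk>f \<in> bdl_hom A B; g \<in> bdl_hom B D; bounded_distributive_lattice A\<rbrakk>
    \<Longrightarrow> compose (carrier A) g f \<in> bdl_hom A D"
  by (auto simp: bdl_hom_def compose_def PiE_iff bounded_distributive_lattice.closed)

text \<open>Every element of \<open>B\<close> is some \<open>f a\<close>, so each operation on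
  \<open>B\<close> is \<open>f\<close> of the operation on \<open>A\<close>, and the inverse strips
  off \<open>f\<close>. Hence the homomorphism equations are applied from right to left.\<close>

lemma inv_bdl_hom:
  assumes "f \<in> bdl_hom A B" and bij: "bij_betw f (carrier A) (carrier B)"
    and "bounded_distributive_lattice A" "bounded_distributive_lattice B"
  shows "(\<lambda>y \<in> carrier B. inv_into (carrier A) f y) \<in> bdl_hom B A"
proof -
  interpret A: bounded_distributive_lattice A by fact
  interpret B: bounded_distributive_lattice B by fact
  have img: "carrier B = f ` carrier A"
    using bij by (simp add: bij_betw_def)
  have inv: "inv_into (carrier A) f (f a) = a" if "a \<in> carrier A" for a
    using that bij by (auto simp: bij_betw_def)
  have hom: "f (a \<sqinter>\<^bsub>A\<^esub> b) = f a \<sqinter>\<^bsub>B\<^esub> f b" "f (a \<squnion>\<^bsub>A\<^esub> b) = f a \<squnion>\<^bsub>B\<^esub> f b"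
    if "a \<in> carrier A" "b \<in> carrier A" for a b
    using that assms(1) by (auto simp: bdl_hom_def)
  have const: "\<zero>\<^bsub>B\<^esub> = f \<zero>\<^bsub>A\<^esub>" "\<one>\<^bsub>B\<^esub> = f \<one>\<^bsub>A\<^esub>"
    using assms(1) by (auto simp: bdl_hom_def)
  show ?thesis
    unfolding bdl_hom_def
    by (auto simp: img inv const simp flip: hom)
qed

text \<open>Closure under implication is assumed directly so that both kinds of algebra are covered.
  An object of \<open>KhBDL\<close> need not be a hemi-implicative lattice: in
  \<open>K_obj H\<close> with \<open>\<zero> \<noteq> \<one>\<close> in \<open>H\<close>, the
  element \<open>\<cc> \<leadsto> \<zero>\<close> is \<open>\<cc>\<close>, yet
  \<open>\<cc> \<sqinter> \<cc>\<close> is not below \<open>\<zero>\<close>.\<close>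

lemma inv_hil_hom:
  assumes "f \<in> hil_hom A B" and bij: "bij_betw f (carrier A) (carrier B)"
    and "bounded_distributive_lattice A" "bounded_distributive_lattice B"
    and closed: "\<And>x y. \<lbrakk>x \<in> carrier A; y \<in> carrier A\<rbrakk> \<Longrightarrow> x \<leadsto>\<^bsub>A\<^esub> y \<in> carrier A"
      "\<And>x y. \<lbrakk>x \<in> carrier B; y \<in> carrier B\<rbrakk> \<Longrightarrow> x \<leadsto>\<^bsub>B\<^esub> y \<in> carrier B"
  shows "(\<lambda>y \<in> carrier B. inv_into (carrier A) f y) \<in> hil_hom B A"
proof -
  have f: "f \<in> bdl_hom A B" and imp: "f (a \<leadsto>\<^bsub>A\<^esub> b) = f a \<leadsto>\<^bsub>B\<^esub> f b"
    if "a \<in> carrier A" "b \<in> carrier A" for a b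
    using that assms(1) by (auto simp: hil_hom_def)
  have img: "carrier B = f ` carrier A"
    using bij by (simp add: bij_betw_def)
  have inv: "inv_into (carrier A) f (f a) = a" if "a \<in> carrier A" for a
    using that bij by (auto simp: bij_betw_def)
  show ?thesis
    using inv_bdl_hom[OF _ bij assms(3,4)] assms(1)
    by (auto simp: hil_hom_def img inv closed simp flip: imp)
qed

lemma inv_khil_hom:
  assumes "f \<in> khil_hom A B" and bij: "bij_betw f (carrier A) (carrier B)"
    and "khbdl_algebra A" "khbdl_algebra B"
  shows "(\<lambda>y \<in> carrier B. inv_into (carrier A) f y) \<in> khil_hom B A"
proof -
  interpret A: khbdl_algebra A by fact
  interpret B: khbdl_algebra B by fact
  have neg: "f (\<sim>\<^bsub>A\<^esub> a) = \<sim>\<^bsub>B\<^esub> (f a)" if "a \<in> carrier A" for a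
    using that assms(1) by (auto simp: khil_hom_def)
  have center: "f \<cc>\<^bsub>A\<^esub> = \<cc>\<^bsub>B\<^esub>" and f: "f \<in> hil_hom A B"
    using assms(1) by (auto simp: khil_hom_def)
  have img: "carrier B = f ` carrier A"
    using bij by (simp add: bij_betw_def)
  have inv: "inv_into (carrier A) f (f a) = a" if "a \<in> carrier A" for a
    using that bij by (auto simp: bij_betw_def)
  have "(\<lambda>y \<in> carrier B. inv_into (carrier A) f y) \<in> hil_hom B A"
    by (rule inv_hil_hom[OF f bij A.bounded_distributive_lattice_axioms
      B.bounded_distributive_lattice_axioms A.imp_closed B.imp_closed])
  then show ?thesis
    using inv[OF A.center_closed]
    by (auto simp: khil_hom_def img inv A.neg_closed A.center_closed simp flip: neg center)
qed

lemma compose_hil_hom: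
  assumes f: "f \<in> hil_hom A B" and g: "g \<in> hil_hom B D"
    and "bounded_distributive_lattice A"
    and closed: "\<And>x y. \<lbrakk>x \<in> carrier A; y \<in> carrier A\<rbrakk> \<Longrightarrow> x \<leadsto>\<^bsub>A\<^esub> y \<in> carrier A"
  shows "compose (carrier A) g f \<in> hil_hom A D"
proof -
  have hom: "f \<in> bdl_hom A B" "g \<in> bdl_hom B D"
    using f g by (auto simp: hil_hom_def)
  have "f x \<in> carrier B" if "x \<in> carrier A" for x
    using that hom by (auto simp: bdl_hom_def)
  then show ?thesis
    using compose_bdl_hom[OF hom assms(3)] f g closed
    by (simp add: hil_hom_def compose_def)
qed

lemma compose_khil_hom:
  assumes f: "f \<in> khil_hom A B" and g: "g \<in> khil_hom B D" and "khbdl_algebra A"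
  shows "compose (carrier A) g f \<in> khil_hom A D"
proof -
  interpret A: khbdl_algebra A by fact
  have hom: "f \<in> hil_hom A B" "g \<in> hil_hom B D"
    using f g by (auto simp: khil_hom_def)
  have "f x \<in> carrier B" if "x \<in> carrier A" for x
    using that hom by (auto simp: hil_hom_def bdl_hom_def)
  then show ?thesis
    using compose_hil_hom[OF hom A.bounded_distributive_lattice_axioms A.imp_closed] f g
      A.neg_closed A.center_closed
    by (simp add: khil_hom_def compose_def)
qed

section \<open>The categories of the equivalence\<close>

lemma category_hBDL: "category hBDL"
  unfolding hBDL_def
proof (rule category_algebra_category)
  fix A B D :: "'a hil" and f g
  show "hil_hom A B \<subseteq> carrier A \<rightarrow>\<^sub>E carrier B"
    by (auto simp: hil_hom_def bdl_hom_def)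
  assume "A \<in> {H. hemi_implicative_lattice H}"
  then interpret hemi_implicative_lattice A by simp
  show "(\<lambda>x \<in> carrier A. x) \<in> hil_hom A A"
    using id_bdl_hom by (simp add: hil_hom_def imp_closed)
  assume "f \<in> hil_hom A B" "g \<in> hil_hom B D"
  then show "compose (carrier A) g f \<in> hil_hom A D"
    using bounded_distributive_lattice_axioms imp_closed by (rule compose_hil_hom)
qed

text \<open>Passing to a full subcategory keeps the homomorphism sets between the remaining objects,
  so the result is again a category of algebras and the general lemmas apply to it directly.\<close>

lemma KhBDL_CK_eq: "KhBDL_CK = algebra_category {T. khbdl_algebra T \<and> CK T} khil_hom"
  by (auto simp: KhBDL_CK_def KhBDL_def full_subcategory_def algebra_category_def)

lemma category_KhBDL_CK: "category KhBDL_CK"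
  unfolding KhBDL_CK_eq
proof (rule category_algebra_category)
  fix A B D :: "'a khil" and f g
  show "khil_hom A B \<subseteq> carrier A \<rightarrow>\<^sub>E carrier B"
    by (auto simp: khil_hom_def hil_hom_def bdl_hom_def)
  assume "A \<in> {T. khbdl_algebra T \<and> CK T}"
  then interpret khbdl_algebra A by simp
  show "(\<lambda>x \<in> carrier A. x) \<in> khil_hom A A"
    using id_bdl_hom by (simp add: khil_hom_def hil_hom_def imp_closed neg_closed center_closed)
  assume "f \<in> khil_hom A B" "g \<in> khil_hom B D"
  then show "compose (carrier A) g f \<in> khil_hom A D"
    using khbdl_algebra_axioms by (rule compose_khil_hom)
qed

section \<open>Bounded distributive lattices\<close>

context bounded_distributive_lattice
begin

lemma meet_idem [simp]: "x \<in> carrier L \<Longrightarrow> x \<sqinter> x = x"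
  by (metis meet_absorb join_absorb meet_closed)

lemma join_idem [simp]: "x \<in> carrier L \<Longrightarrow> x \<squnion> x = x"
  by (metis meet_absorb join_absorb join_closed)

lemma meet_left_comm:
  "\<lbrakk>x \<in> carrier L; y \<in> carrier L; z \<in> carrier L\<rbrakk> \<Longrightarrow> x \<sqinter> (y \<sqinter> z) = y \<sqinter> (x \<sqinter> z)"
  by (metis meet_assoc meet_comm)

lemma join_left_comm:
  "\<lbrakk>x \<in> carrier L; y \<in> carrier L; z \<in> carrier L\<rbrakk> \<Longrightarrow> x \<squnion> (y \<squnion> z) = y \<squnion> (x \<squnion> z)"
  by (metis join_assoc join_comm)

lemmas meet_ac = meet_assoc meet_comm meet_left_comm

lemma meet_zero [simp]: "x \<in> carrier L \<Longrightarrow> x \<sqinter> \<zero> = \<zero>" "x \<in> carrier L \<Longrightarrow> \<zero> \<sqinter> x = \<zero>"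
  using zero_least meet_comm by (auto simp: leq_def)

lemma meet_one [simp]: "x \<in> carrier L \<Longrightarrow> x \<sqinter> \<one> = x" "x \<in> carrier L \<Longrightarrow> \<one> \<sqinter> x = x"
  using one_greatest meet_comm by (auto simp: leq_def)

lemma join_zero [simp]: "x \<in> carrier L \<Longrightarrow> x \<squnion> \<zero> = x" "x \<in> carrier L \<Longrightarrow> \<zero> \<squnion> x = x"
  by (metis join_absorb join_comm meet_zero(1) zero_closed)+

lemma join_one [simp]: "x \<in> carrier L \<Longrightarrow> x \<squnion> \<one> = \<one>" "x \<in> carrier L \<Longrightarrow> \<one> \<squnion> x = \<one>"
  by (metis join_absorb join_comm meet_one(2) one_closed)+

lemma meet_distrib_right:
  "\<lbrakk>x \<in> carrier L; y \<in> carrier L; z \<in> carrier L\<rbrakk> \<Longrightarrow> (y \<squnion> z) \<sqinter> x = (y \<sqinter> x) \<squnion> (z \<sqinter> x)"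
  by (simp add: meet_distrib meet_comm)

text \<open>Only distribution of meet over join is an axiom. The dual law follows by expanding the
  right-hand side and absorbing twice.\<close>

lemma join_distrib:
  assumes "x \<in> carrier L" "y \<in> carrier L" "z \<in> carrier L"
  shows "x \<squnion> (y \<sqinter> z) = (x \<squnion> y) \<sqinter> (x \<squnion> z)"
proof -
  have "(x \<squnion> y) \<sqinter> (x \<squnion> z) = ((x \<squnion> y) \<sqinter> x) \<squnion> ((x \<squnion> y) \<sqinter> z)"
    using assms by (simp add: meet_distrib)
  also have "(x \<squnion> y) \<sqinter> x = x"
    using assms by (simp add: meet_absorb meet_comm[of "x \<squnion> y"])
  also have "(x \<squnion> y) \<sqinter> z = (x \<sqinter> z) \<squnion> (y \<sqinter> z)"
    using assms by (simp add: meet_distrib_right)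
  also have "x \<squnion> ((x \<sqinter> z) \<squnion> (y \<sqinter> z)) = (x \<squnion> (x \<sqinter> z)) \<squnion> (y \<sqinter> z)"
    using assms by (simp add: join_assoc)
  also have "x \<squnion> (x \<sqinter> z) = x"
    using assms by (simp add: join_absorb)
  finally show ?thesis by simp
qed

lemma join_distrib_right:
  "\<lbrakk>x \<in> carrier L; y \<in> carrier L; z \<in> carrier L\<rbrakk> \<Longrightarrow> (y \<sqinter> z) \<squnion> x = (y \<squnion> x) \<sqinter> (z \<squnion> x)"
  by (simp add: join_distrib join_comm)

lemma leq_iff_join: "\<lbrakk>x \<in> carrier L; y \<in> carrier L\<rbrakk> \<Longrightarrow> x \<sqsubseteq> y \<longleftrightarrow> x \<squnion> y = y"
  unfolding leq_def by (metis join_absorb join_comm meet_absorb meet_comm)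

text \<open>This is cancellation in distributive lattices: in \<open>x = x \<sqinter> (y \<squnion>
  z) = (x \<sqinter> y) \<squnion> (x \<sqinter> z)\<close> the last meet may be exchanged for
  \<open>y \<sqinter> z\<close>. It is applied with \<open>z\<close> equal to
  \<open>\<cc>\<close>.\<close>

lemma eq_from_meet_join:
  assumes "x \<in> carrier L" "y \<in> carrier L" "z \<in> carrier L"
    and "x \<sqinter> z = y \<sqinter> z" "x \<squnion> z = y \<squnion> z"
  shows "x = y"
proof -
  have "x = x \<sqinter> (y \<squnion> z)" using assms by (metis meet_absorb)
  also have "\<dots> = y \<sqinter> (x \<squnion> z)" using assms by (metis meet_distrib meet_comm)
  also have "\<dots> = y" using assms by (metis meet_absorb)
  finally show ?thesis .
qed

end

section \<open>The functor K\<close>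

lemma K_obj_simps [simp]:
  "Pair a b \<in> carrier (K_obj H) \<longleftrightarrow> a \<in> carrier H \<and> b \<in> carrier H \<and> a \<sqinter>\<^bsub>H\<^esub> b = \<zero>\<^bsub>H\<^esub>"
  "Pair a b \<sqinter>\<^bsub>K_obj H\<^esub> Pair d e = Pair (a \<sqinter>\<^bsub>H\<^esub> d) (b \<squnion>\<^bsub>H\<^esub> e)"
  "Pair a b \<squnion>\<^bsub>K_obj H\<^esub> Pair d e = Pair (a \<squnion>\<^bsub>H\<^esub> d) (b \<sqinter>\<^bsub>H\<^esub> e)"
  "\<zero>\<^bsub>K_obj H\<^esub> = Pair \<zero>\<^bsub>H\<^esub> \<one>\<^bsub>H\<^esub>"
  "\<one>\<^bsub>K_obj H\<^esub> = Pair \<one>\<^bsub>H\<^esub> \<zero>\<^bsub>H\<^esub>"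
  "Pair a b \<leadsto>\<^bsub>K_obj H\<^esub> Pair d e = Pair ((a \<leadsto>\<^bsub>H\<^esub> d) \<sqinter>\<^bsub>H\<^esub> (e \<leadsto>\<^bsub>H\<^esub> b)) (a \<sqinter>\<^bsub>H\<^esub> e)"
  "\<sim>\<^bsub>K_obj H\<^esub> (Pair a b) = Pair b a"
  "\<cc>\<^bsub>K_obj H\<^esub> = Pair \<zero>\<^bsub>H\<^esub> \<zero>\<^bsub>H\<^esub>"
  by (simp_all add: K_obj_def)

lemma K_obj_cases:
  assumes "x \<in> carrier (K_obj H)"
  obtains a b where "x = Pair a b" "a \<in> carrier H" "b \<in> carrier H" "a \<sqinter>\<^bsub>H\<^esub> b = \<zero>\<^bsub>H\<^esub>"
  using assms by (auto simp: K_obj_def)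

context bounded_distributive_lattice
begin

text \<open>Shrinking one of two disjoint elements keeps them disjoint. After distributing, this is
  what closure of \<open>K_obj\<close> under meet and join requires.\<close>

lemma meet_zero_mono:
  assumes "a \<in> carrier L" "b \<in> carrier L" "d \<in> carrier L" "a \<sqinter> b = \<zero>"
  shows "(a \<sqinter> d) \<sqinter> b = \<zero>" "(d \<sqinter> a) \<sqinter> b = \<zero>" "a \<sqinter> (b \<sqinter> d) = \<zero>" "a \<sqinter> (d \<sqinter> b) = \<zero>"
  using assms by (metis meet_assoc meet_comm meet_closed meet_zero)+

end

context hemi_implicative_lattice
begin

text \<open>The axiom \<open>imp_meet\<close> is taken at the largest element allowed by its
  premise, namely \<open>a \<leadsto> b\<close> itself.\<close>

lemma modus_ponens: "\<lbrakk>a \<in> carrier H; b \<in> carrier H\<rbrakk> \<Longrightarrow> (a \<leadsto> b) \<sqinter> a \<sqsubseteq> b"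
  using imp_meet[of "a \<leadsto> b" a b] by (simp add: imp_closed leq_def)

end

text \<open>The element type is fixed to one closed under pairing, because \<open>K_obj\<close> is
  defined only there.\<close>

locale univ_hil = hemi_implicative_lattice H for H :: "'a univ hil" (structure)
begin

text \<open>The second component carries the dual order, so each law of \<open>K_obj H\<close> is
  that law of \<open>H\<close> in the first component and its dual in the second. Disjointness
  enters only through closure.\<close>

lemma bounded_distributive_lattice_K_obj: "bounded_distributive_lattice (K_obj H)"
proof
  fix x y z assume x: "x \<in> carrier (K_obj H)" 
  show "\<zero>\<^bsub>K_obj H\<^esub> \<sqsubseteq>\<^bsub>K_obj H\<^esub> x" "x \<sqsubseteq>\<^bsub>K_obj H\<^esub> \<one>\<^bsub>K_obj H\<^esub>"
    using x by (auto simp: leq_def elim!: K_obj_cases)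
  assume y: "y \<in> carrier (K_obj H)"
  obtain a b where ab: "x = Pair a b" "a \<in> carrier H" "b \<in> carrier H" "a \<sqinter> b = \<zero>"
    using x by (rule K_obj_cases)
  obtain d e where de: "y = Pair d e" "d \<in> carrier H" "e \<in> carrier H" "d \<sqinter> e = \<zero>"
    using y by (rule K_obj_cases)
  show "x \<sqinter>\<^bsub>K_obj H\<^esub> y \<in> carrier (K_obj H)"
    using ab de meet_zero_mono(1)[of a b d] meet_zero_mono(2)[of d e a]
    by (simp add: meet_distrib)
  show "x \<squnion>\<^bsub>K_obj H\<^esub> y \<in> carrier (K_obj H)"
    using ab de meet_zero_mono(3)[of a b e] meet_zero_mono(4)[of d e b]
    by (simp add: meet_distrib_right)
  show "x \<sqinter>\<^bsub>K_obj H\<^esub> y = y \<sqinter>\<^bsub>K_obj H\<^esub> x" "x \<squnion>\<^bsub>K_obj H\<^esub> y = y \<squnion>\<^bsub>K_obj H\<^esub> x"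
    using ab de by (simp_all add: meet_comm[of a d] meet_comm[of b e] join_comm[of a d] join_comm[of b e])
  show "x \<sqinter>\<^bsub>K_obj H\<^esub> (x \<squnion>\<^bsub>K_obj H\<^esub> y) = x" "x \<squnion>\<^bsub>K_obj H\<^esub> (x \<sqinter>\<^bsub>K_obj H\<^esub> y) = x"
    using ab de by (simp_all add: meet_absorb join_absorb)
  assume z: "z \<in> carrier (K_obj H)"
  obtain p q where pq: "z = Pair p q" "p \<in> carrier H" "q \<in> carrier H" "p \<sqinter> q = \<zero>"
    using z by (rule K_obj_cases)
  show "(x \<sqinter>\<^bsub>K_obj H\<^esub> y) \<sqinter>\<^bsub>K_obj H\<^esub> z = x \<sqinter>\<^bsub>K_obj H\<^esub> (y \<sqinter>\<^bsub>K_obj H\<^esub> z)"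
    "(x \<squnion>\<^bsub>K_obj H\<^esub> y) \<squnion>\<^bsub>K_obj H\<^esub> z = x \<squnion>\<^bsub>K_obj H\<^esub> (y \<squnion>\<^bsub>K_obj H\<^esub> z)"
    using ab de pq by (simp_all add: meet_assoc join_assoc)
  show "x \<sqinter>\<^bsub>K_obj H\<^esub> (y \<squnion>\<^bsub>K_obj H\<^esub> z) = (x \<sqinter>\<^bsub>K_obj H\<^esub> y) \<squnion>\<^bsub>K_obj H\<^esub> (x \<sqinter>\<^bsub>K_obj H\<^esub> z)"
    using ab de pq by (simp add: meet_distrib[of a d p] join_distrib[of b e q])
qed auto

lemma khbdl_algebra_K_obj: "khbdl_algebra (K_obj H)"
proof -
  interpret K: bounded_distributive_lattice "K_obj H"
    by (rule bounded_distributive_lattice_K_obj)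
  show ?thesis
  proof
    fix x y assume x: "x \<in> carrier (K_obj H)"
    show "\<sim>\<^bsub>K_obj H\<^esub> x \<in> carrier (K_obj H)" "\<sim>\<^bsub>K_obj H\<^esub> (\<sim>\<^bsub>K_obj H\<^esub> x) = x"
      "x \<leadsto>\<^bsub>K_obj H\<^esub> x = \<one>\<^bsub>K_obj H\<^esub>"
      using x by (auto simp: meet_comm imp_refl elim!: K_obj_cases)
    assume y: "y \<in> carrier (K_obj H)"
    obtain a b where x: "x = Pair a b" "a \<in> carrier H" "b \<in> carrier H" "a \<sqinter> b = \<zero>"
      using x by (rule K_obj_cases)
    obtain d e where y: "y = Pair d e" "d \<in> carrier H" "e \<in> carrier H" "d \<sqinter> e = \<zero>"
      using y by (rule K_obj_cases)
    \<comment> \<open>This is modus ponens as an equation, which allows \<open>d\<close> to be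
      inserted next to \<open>a \<leadsto> d\<close> and \<open>a\<close>.\<close>
    have mp: "(a \<leadsto> d) \<sqinter> (a \<sqinter> d) = (a \<leadsto> d) \<sqinter> a"
      using modus_ponens[of a d] x y by (simp add: leq_def meet_assoc imp_closed)
    show "\<sim>\<^bsub>K_obj H\<^esub> (x \<squnion>\<^bsub>K_obj H\<^esub> y) = (\<sim>\<^bsub>K_obj H\<^esub> x) \<sqinter>\<^bsub>K_obj H\<^esub> (\<sim>\<^bsub>K_obj H\<^esub> y)"
      using x y by simp
    \<comment> \<open>By disjointness the left side is \<open>Pair \<zero> (a \<squnion> b)\<close>
      and the right side is \<open>Pair (d \<squnion> e) \<zero>\<close>, up to commutativity, so
      the center lies between them.\<close>
    show "x \<sqinter>\<^bsub>K_obj H\<^esub> (\<sim>\<^bsub>K_obj H\<^esub> x) \<sqsubseteq>\<^bsub>K_obj H\<^esub> y \<squnion>\<^bsub>K_obj H\<^esub> (\<sim>\<^bsub>K_obj H\<^esub> y)"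
      using x y by (simp add: leq_def meet_comm)
    \<comment> \<open>The two components of the implication must be disjoint. Modus ponens produces
      \<open>d\<close> from \<open>a\<close>, and \<open>d\<close> is disjoint from
      \<open>e\<close>.\<close>
    have "((a \<leadsto> d) \<sqinter> (e \<leadsto> b)) \<sqinter> (a \<sqinter> e) = (e \<leadsto> b) \<sqinter> (((a \<leadsto> d) \<sqinter> a) \<sqinter> e)"
      using x y by (simp add: meet_ac imp_closed)
    also have "(a \<leadsto> d) \<sqinter> a = (a \<leadsto> d) \<sqinter> (a \<sqinter> d)"
      by (simp only: mp)
    also have "(e \<leadsto> b) \<sqinter> (((a \<leadsto> d) \<sqinter> (a \<sqinter> d)) \<sqinter> e) = \<zero>"
      using x y by (simp add: meet_assoc imp_closed)
    finally show "x \<leadsto>\<^bsub>K_obj H\<^esub> y \<in> carrier (K_obj H)"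
      using x y by (simp add: imp_closed)
    show "\<cc>\<^bsub>K_obj H\<^esub> \<sqsubseteq>\<^bsub>K_obj H\<^esub> x \<leadsto>\<^bsub>K_obj H\<^esub> (y \<squnion>\<^bsub>K_obj H\<^esub> \<cc>\<^bsub>K_obj H\<^esub>)"
      using x y by (simp add: leq_def imp_closed)
    \<comment> \<open>Joining with the center replaces the second component by
      \<open>\<zero>\<close>, and \<open>\<zero> \<leadsto> \<zero> = \<one>\<close>, so the inner
      implication is \<open>Pair (a \<leadsto> d) \<zero>\<close>. The claim reduces to
      \<open>mp\<close>.\<close>
    show "x \<sqinter>\<^bsub>K_obj H\<^esub> ((x \<squnion>\<^bsub>K_obj H\<^esub> \<cc>\<^bsub>K_obj H\<^esub>) \<leadsto>\<^bsub>K_obj H\<^esub> (y \<squnion>\<^bsub>K_obj H\<^esub> \<cc>\<^bsub>K_obj H\<^esub>))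
        \<sqsubseteq>\<^bsub>K_obj H\<^esub> y \<squnion>\<^bsub>K_obj H\<^esub> \<cc>\<^bsub>K_obj H\<^esub>"
      using x y mp by (simp add: leq_def imp_closed imp_refl meet_assoc meet_comm[of a "a \<leadsto> d"])
    \<comment> \<open>Meeting with the center erases first components, so (K4) only records that the
      second component of the implication is \<open>a \<sqinter> e\<close>. Dually, (K5) below only
      concerns the first component.\<close>
    show "(x \<leadsto>\<^bsub>K_obj H\<^esub> y) \<sqinter>\<^bsub>K_obj H\<^esub> \<cc>\<^bsub>K_obj H\<^esub> =
        ((\<sim>\<^bsub>K_obj H\<^esub> x) \<sqinter>\<^bsub>K_obj H\<^esub> \<cc>\<^bsub>K_obj H\<^esub>) \<squnion>\<^bsub>K_obj H\<^esub> (y \<sqinter>\<^bsub>K_obj H\<^esub> \<cc>\<^bsub>K_obj H\<^esub>)"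
      using x y by (simp add: imp_closed)
    show "(x \<leadsto>\<^bsub>K_obj H\<^esub> (\<sim>\<^bsub>K_obj H\<^esub> y)) \<squnion>\<^bsub>K_obj H\<^esub> \<cc>\<^bsub>K_obj H\<^esub> =
        ((x \<squnion>\<^bsub>K_obj H\<^esub> \<cc>\<^bsub>K_obj H\<^esub>) \<leadsto>\<^bsub>K_obj H\<^esub> ((\<sim>\<^bsub>K_obj H\<^esub> y) \<squnion>\<^bsub>K_obj H\<^esub> \<cc>\<^bsub>K_obj H\<^esub>))
        \<sqinter>\<^bsub>K_obj H\<^esub> ((y \<squnion>\<^bsub>K_obj H\<^esub> \<cc>\<^bsub>K_obj H\<^esub>) \<leadsto>\<^bsub>K_obj H\<^esub> ((\<sim>\<^bsub>K_obj H\<^esub> x) \<squnion>\<^bsub>K_obj H\<^esub> \<cc>\<^bsub>K_obj H\<^esub>))"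
      using x y by (simp add: imp_closed imp_refl)
  qed auto
qed

text \<open>Since the second component is ordered dually, lying above the center forces it down to
  the bottom of \<open>H\<close>.\<close>

lemma center_leq_K_obj_iff:
  "\<lbrakk>a \<in> carrier H; b \<in> carrier H\<rbrakk> \<Longrightarrow> \<cc>\<^bsub>K_obj H\<^esub> \<sqsubseteq>\<^bsub>K_obj H\<^esub> Pair a b \<longleftrightarrow> b = \<zero>"
  by (simp add: leq_def)

lemma CK_K_obj: "CK (K_obj H)"
  unfolding CK_def
proof (intro ballI impI)
  fix x y assume x: "x \<in> carrier (K_obj H)" and y: "y \<in> carrier (K_obj H)"
  assume *: "\<cc>\<^bsub>K_obj H\<^esub> \<sqsubseteq>\<^bsub>K_obj H\<^esub> x \<and> \<cc>\<^bsub>K_obj H\<^esub> \<sqsubseteq>\<^bsub>K_obj H\<^esub> y \<and>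
    x \<sqinter>\<^bsub>K_obj H\<^esub> y = \<cc>\<^bsub>K_obj H\<^esub>"
  \<comment> \<open>The rule unfolding the center is removed so that
    \<open>center_leq_K_obj_iff\<close> can match.\<close>
  obtain a where a: "x = Pair a \<zero>" "a \<in> carrier H"
    using x * by (auto simp: center_leq_K_obj_iff simp del: K_obj_simps(8) elim!: K_obj_cases)
  obtain d where d: "y = Pair d \<zero>" "d \<in> carrier H"
    using y * by (auto simp: center_leq_K_obj_iff simp del: K_obj_simps(8) elim!: K_obj_cases)
  show "\<exists>z \<in> carrier (K_obj H). z \<squnion>\<^bsub>K_obj H\<^esub> \<cc>\<^bsub>K_obj H\<^esub> = x \<and>
      (\<sim>\<^bsub>K_obj H\<^esub> z) \<squnion>\<^bsub>K_obj H\<^esub> \<cc>\<^bsub>K_obj H\<^esub> = y"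
    \<comment> \<open>The assumption on the meet says exactly that \<open>a\<close> and
      \<open>d\<close> are disjoint, so \<open>Pair a d\<close> is an element and serves as
      \<open>z\<close>.\<close>
    using a d * by (intro bexI[of _ "Pair a d"]) auto
qed

end


section \<open>The action of K on homomorphisms\<close>

lemma K_map_hom:
  assumes f: "f \<in> hil_hom G H" and G: "hemi_implicative_lattice G" and H: "hemi_implicative_lattice H"
  shows "(\<lambda>x \<in> carrier (K_obj G). Pair (f (pfst x)) (f (psnd x))) \<in> khil_hom (K_obj G) (K_obj H)"
proof -
  interpret G: univ_hil G using G by (rule univ_hil.intro)
  interpret KG: khbdl_algebra "K_obj G" by (rule G.khbdl_algebra_K_obj)
  have hom: "f a \<in> carrier H" "f (a \<sqinter>\<^bsub>G\<^esub> b) = f a \<sqinter>\<^bsub>H\<^esub> f b" "f (a \<squnion>\<^bsub>G\<^esub> b) = f a \<squnion>\<^bsub>H\<^esub> f b"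
    "f (a \<leadsto>\<^bsub>G\<^esub> b) = f a \<leadsto>\<^bsub>H\<^esub> f b"
    if "a \<in> carrier G" "b \<in> carrier G" for a b
    using that f by (auto simp: hil_hom_def bdl_hom_def)
  have const: "f \<zero>\<^bsub>G\<^esub> = \<zero>\<^bsub>H\<^esub>" "f \<one>\<^bsub>G\<^esub> = \<one>\<^bsub>H\<^esub>"
    using f by (auto simp: hil_hom_def bdl_hom_def)
  let ?h = "\<lambda>x \<in> carrier (K_obj G). Pair (f (pfst x)) (f (psnd x))"
  have h: "?h x = Pair (f (pfst x)) (f (psnd x))" if "x \<in> carrier (K_obj G)" for x
    using that by simp
  \<comment> \<open>Disjointness survives because \<open>f\<close> preserves meets and the
    bottom.\<close>
  have "?h \<in> carrier (K_obj G) \<rightarrow>\<^sub>E carrier (K_obj H)"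
    by (auto simp: hom const simp flip: hom(2) elim!: K_obj_cases)
  moreover have
    "?h (x \<sqinter>\<^bsub>K_obj G\<^esub> y) = ?h x \<sqinter>\<^bsub>K_obj H\<^esub> ?h y \<and>
     ?h (x \<squnion>\<^bsub>K_obj G\<^esub> y) = ?h x \<squnion>\<^bsub>K_obj H\<^esub> ?h y \<and>
     ?h (x \<leadsto>\<^bsub>K_obj G\<^esub> y) = ?h x \<leadsto>\<^bsub>K_obj H\<^esub> ?h y \<and>
     ?h (\<sim>\<^bsub>K_obj G\<^esub> x) = \<sim>\<^bsub>K_obj H\<^esub> (?h x)"
    if x: "x \<in> carrier (K_obj G)" and y: "y \<in> carrier (K_obj G)" for x y
    unfolding h[OF x] h[OF y] h[OF KG.meet_closed[OF x y]] h[OF KG.join_closed[OF x y]]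
      h[OF KG.imp_closed[OF x y]] h[OF KG.neg_closed[OF x]]
    using x y by (auto simp: hom G.imp_closed elim!: K_obj_cases)
  moreover have "?h \<zero>\<^bsub>K_obj G\<^esub> = \<zero>\<^bsub>K_obj H\<^esub>" "?h \<one>\<^bsub>K_obj G\<^esub> = \<one>\<^bsub>K_obj H\<^esub>"
    "?h \<cc>\<^bsub>K_obj G\<^esub> = \<cc>\<^bsub>K_obj H\<^esub>"
    by (simp_all add: const)
  ultimately show ?thesis
    unfolding khil_hom_def hil_hom_def bdl_hom_def by blast
qed

section \<open>The functor C\<close>

lemma C_obj_simps [simp]:
  "meet (C_obj T) = meet T" "join (C_obj T) = join T" "imp (C_obj T) = imp T"
  "\<zero>\<^bsub>C_obj T\<^esub> = \<cc>\<^bsub>T\<^esub>" "\<one>\<^bsub>C_obj T\<^esub> = \<one>\<^bsub>T\<^esub>" "leq (C_obj T) = leq T"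
  by (simp_all add: C_obj_def leq_def fun_eq_iff)

context centered_kleene_algebra
begin

lemmas unary_closed [simp] = neg_closed center_closed

lemma neg_center_eq [simp]: "\<sim> \<cc> = \<cc>"
  using neg_center by simp

lemma neg_meet: "\<lbrakk>x \<in> carrier T; y \<in> carrier T\<rbrakk> \<Longrightarrow> \<sim> (x \<sqinter> y) = (\<sim> x) \<squnion> (\<sim> y)"
  using neg_join[of "\<sim> x" "\<sim> y"] neg_neg[of "(\<sim> x) \<squnion> (\<sim> y)"] by (simp add: neg_neg)

text \<open>Negating \<open>(\<sim> \<zero>) \<squnion> \<one> = \<one>\<close> turns its left side
  into \<open>\<zero> \<sqinter> (\<sim> \<one>)\<close>, which is \<open>\<zero>\<close>.\<close>

lemma neg_one: "\<sim> \<one> = \<zero>"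
  using neg_join[of "\<sim> \<zero>" \<one>] by (simp add: neg_neg)

lemma neg_zero: "\<sim> \<zero> = \<one>"
  using neg_neg[of \<one>] by (simp add: neg_one)

text \<open>The Kleene inequality against the center gives
  \<open>x \<sqinter> (\<sim> x) \<sqsubseteq> \<cc>\<close>. Since \<open>\<cc>\<close> is the
  bottom of \<open>C_obj T\<close>, this is the disjointness that makes \<open>beta\<close> take
  values in \<open>K_obj (C_obj T)\<close>.\<close>

lemma join_center_meet_neg:
  assumes "x \<in> carrier T"
  shows "(x \<squnion> \<cc>) \<sqinter> ((\<sim> x) \<squnion> \<cc>) = \<cc>"
proof -
  have "(x \<squnion> \<cc>) \<sqinter> ((\<sim> x) \<squnion> \<cc>) = (x \<sqinter> (\<sim> x)) \<squnion> \<cc>"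
    using assms by (simp add: join_distrib_right)
  also have "\<dots> = \<cc>"
    using assms kleene[of x \<cc>] by (simp add: leq_iff_join)
  finally show ?thesis .
qed

end

locale plain_khbdl = khbdl_algebra T for T :: "'u khil" (structure)
begin

text \<open>Membership is put as an equation so that closure of \<open>C_obj T\<close> becomes
  rewriting with the lattice laws.\<close>

lemma carrier_C_obj [simp]: "x \<in> carrier (C_obj T) \<longleftrightarrow> x \<in> carrier T \<and> x \<squnion> \<cc> = x"
  by (auto simp: C_obj_def leq_iff_join join_comm)

text \<open>For \<open>b\<close> and \<open>d\<close> above the center, (K2) reads
  \<open>b \<sqinter> (b \<leadsto> d) \<sqsubseteq> d\<close>, and \<open>a\<close> is below
  \<open>b \<leadsto> d\<close>.\<close>

lemma leq_meet_imp:
  assumes "a \<in> carrier T" "b \<in> carrier T" "d \<in> carrier T" "b \<squnion> \<cc> = b" "d \<squnion> \<cc> = d"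
    and "a \<sqsubseteq> b \<leadsto> d"
  shows "a \<sqinter> b \<sqsubseteq> d"
proof -
  have i: "b \<leadsto> d \<in> carrier T"
    using assms by (simp add: imp_closed)
  have "b \<sqinter> (b \<leadsto> d) \<sqsubseteq> d"
    using K2[of b d] assms by simp
  moreover have "a \<sqinter> b = a \<sqinter> (b \<sqinter> (b \<leadsto> d))"
    using assms i unfolding leq_def by (metis meet_assoc meet_comm)
  ultimately show ?thesis
    using assms i unfolding leq_def by (metis meet_assoc meet_closed)
qed

lemma hemi_implicative_lattice_C_obj: "hemi_implicative_lattice (C_obj T)"
proof
  fix x y assume x: "x \<in> carrier (C_obj T)"
  show "\<zero>\<^bsub>C_obj T\<^esub> \<sqsubseteq>\<^bsub>C_obj T\<^esub> x" "x \<sqsubseteq>\<^bsub>C_obj T\<^esub> \<one>\<^bsub>C_obj T\<^esub>"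
    "x \<leadsto>\<^bsub>C_obj T\<^esub> x = \<one>\<^bsub>C_obj T\<^esub>"
    using x by (auto simp: K3 one_greatest leq_iff_join join_comm)
  assume y: "y \<in> carrier (C_obj T)"
  show "x \<sqinter>\<^bsub>C_obj T\<^esub> y \<in> carrier (C_obj T)"
    using x y by (simp add: join_distrib_right)
  show "x \<squnion>\<^bsub>C_obj T\<^esub> y \<in> carrier (C_obj T)"
    using x y by (simp add: join_assoc)
  show "x \<leadsto>\<^bsub>C_obj T\<^esub> y \<in> carrier (C_obj T)"
    using x y K1[of x y] by (simp add: leq_iff_join imp_closed join_comm[of \<cc>])
  show "x \<sqinter>\<^bsub>C_obj T\<^esub> y = y \<sqinter>\<^bsub>C_obj T\<^esub> x" "x \<squnion>\<^bsub>C_obj T\<^esub> y = y \<squnion>\<^bsub>C_obj T\<^esub> x"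
    using x y meet_comm join_comm by auto
  show "x \<sqinter>\<^bsub>C_obj T\<^esub> (x \<squnion>\<^bsub>C_obj T\<^esub> y) = x" "x \<squnion>\<^bsub>C_obj T\<^esub> (x \<sqinter>\<^bsub>C_obj T\<^esub> y) = x"
    using x y by (auto simp: meet_absorb join_absorb)
qed (auto simp: meet_assoc join_assoc meet_distrib leq_meet_imp)

end

lemma C_map_hom:
  assumes f: "f \<in> khil_hom T U" and "khbdl_algebra T" and "khbdl_algebra U"
  shows "restrict f (carrier (C_obj T)) \<in> hil_hom (C_obj T) (C_obj U)"
proof -
  interpret T: plain_khbdl T using assms by (intro plain_khbdl.intro)
  interpret U: plain_khbdl U using assms by (intro plain_khbdl.intro)
  interpret CT: hemi_implicative_lattice "C_obj T" by (rule T.hemi_implicative_lattice_C_obj)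
  have hom: "f a \<in> carrier U" "f (a \<sqinter>\<^bsub>T\<^esub> b) = f a \<sqinter>\<^bsub>U\<^esub> f b" "f (a \<squnion>\<^bsub>T\<^esub> b) = f a \<squnion>\<^bsub>U\<^esub> f b"
    "f (a \<leadsto>\<^bsub>T\<^esub> b) = f a \<leadsto>\<^bsub>U\<^esub> f b"
    if "a \<in> carrier T" "b \<in> carrier T" for a b
    using that f by (auto simp: khil_hom_def hil_hom_def bdl_hom_def)
  have const: "f \<cc>\<^bsub>T\<^esub> = \<cc>\<^bsub>U\<^esub>" "f \<one>\<^bsub>T\<^esub> = \<one>\<^bsub>U\<^esub>"
    using f by (auto simp: khil_hom_def hil_hom_def bdl_hom_def)
  let ?h = "restrict f (carrier (C_obj T))"
  \<comment> \<open>Applying \<open>f\<close> to \<open>x \<squnion> \<cc> = x\<close> gives the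
    same equation for \<open>f x\<close>.\<close>
  have "f x \<in> carrier (C_obj U)" if "x \<in> carrier (C_obj T)" for x
    using that hom(1,3)[of x "\<cc>\<^bsub>T\<^esub>"] const by simp
  then have "?h \<in> carrier (C_obj T) \<rightarrow>\<^sub>E carrier (C_obj U)"
    by simp
  moreover have
    "?h (x \<sqinter>\<^bsub>C_obj T\<^esub> y) = ?h x \<sqinter>\<^bsub>C_obj U\<^esub> ?h y \<and>
     ?h (x \<squnion>\<^bsub>C_obj T\<^esub> y) = ?h x \<squnion>\<^bsub>C_obj U\<^esub> ?h y \<and>
     ?h (x \<leadsto>\<^bsub>C_obj T\<^esub> y) = ?h x \<leadsto>\<^bsub>C_obj U\<^esub> ?h y"
    if x: "x \<in> carrier (C_obj T)" and y: "y \<in> carrier (C_obj T)" for x y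
    unfolding restrict_apply'[OF x] restrict_apply'[OF y] restrict_apply'[OF CT.meet_closed[OF x y]]
      restrict_apply'[OF CT.join_closed[OF x y]] restrict_apply'[OF CT.imp_closed[OF x y]]
    using x y by (simp add: hom)
  moreover have "?h \<zero>\<^bsub>C_obj T\<^esub> = \<zero>\<^bsub>C_obj U\<^esub>" "?h \<one>\<^bsub>C_obj T\<^esub> = \<one>\<^bsub>C_obj U\<^esub>"
    by (simp_all add: const)
  ultimately show ?thesis
    unfolding hil_hom_def bdl_hom_def by blast
qed

section \<open>The unit and the counit\<close>

context univ_hil
begin

lemma carrier_C_K: "carrier (C_obj (K_obj H)) = (\<lambda>a. Pair a \<zero>) ` carrier H"
  by (auto simp: C_obj_def center_leq_K_obj_iff simp del: K_obj_simps(8) elim!: K_obj_cases)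

lemma alpha_bij: "bij_betw (map_of_arrow (alpha H)) (carrier H) (carrier (C_obj (K_obj H)))"
  by (auto simp: carrier_C_K alpha_def bij_betw_def inj_on_def)

text \<open>For implication the extra factor in the first component is
  \<open>\<zero> \<leadsto> \<zero> = \<one>\<close>. The bottom goes to the center, which is the
  bottom of \<open>C_obj (K_obj H)\<close>.\<close>

lemma alpha_hom: "map_of_arrow (alpha H) \<in> hil_hom H (C_obj (K_obj H))"
  by (auto simp: alpha_def hil_hom_def bdl_hom_def carrier_C_K imp_closed imp_refl)

end

locale univ_khbdl = plain_khbdl T for T :: "'a univ khil" (structure)
begin

lemma beta_apply [simp]: "x \<in> carrier T \<Longrightarrow> map_of_arrow (beta T) x = Pair (x \<squnion> \<cc>) ((\<sim> x) \<squnion> \<cc>)"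
  by (simp add: beta_def)

lemma beta_hom: "map_of_arrow (beta T) \<in> khil_hom T (K_obj (C_obj T))"
proof -
  have "map_of_arrow (beta T) \<in> carrier T \<rightarrow>\<^sub>E carrier (K_obj (C_obj T))"
    by (auto simp: beta_def join_assoc join_center_meet_neg)
  moreover have "map_of_arrow (beta T) (x \<sqinter> y) =
      map_of_arrow (beta T) x \<sqinter>\<^bsub>K_obj (C_obj T)\<^esub> map_of_arrow (beta T) y"
    if "x \<in> carrier T" "y \<in> carrier T" for x y
    using that by (simp add: join_distrib_right neg_meet join_assoc join_left_comm[of \<cc>])
  moreover have "map_of_arrow (beta T) (x \<squnion> y) =
      map_of_arrow (beta T) x \<squnion>\<^bsub>K_obj (C_obj T)\<^esub> map_of_arrow (beta T) y"
    if "x \<in> carrier T" "y \<in> carrier T" for x y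
    using that by (simp add: join_distrib_right neg_join join_assoc join_left_comm[of \<cc>])
  moreover have "map_of_arrow (beta T) (x \<leadsto> y) =
      map_of_arrow (beta T) x \<leadsto>\<^bsub>K_obj (C_obj T)\<^esub> map_of_arrow (beta T) y"
    if xy: "x \<in> carrier T" "y \<in> carrier T" for x y
  proof -
    \<comment> \<open>The chain ends in the meet of the first component of \<open>beta\<close> at
      \<open>x\<close> with the second one at \<open>y\<close>, as the implication of
      \<open>K_obj\<close> prescribes.\<close>
    have "(\<sim> (x \<leadsto> y)) \<squnion> \<cc> = \<sim> ((x \<leadsto> y) \<sqinter> \<cc>)"
      using xy by (simp add: neg_meet imp_closed)
    also have "\<dots> = (x \<squnion> \<cc>) \<sqinter> ((\<sim> y) \<squnion> \<cc>)"
      using xy by (simp add: K4 neg_meet neg_join neg_neg)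
    finally show ?thesis
      using xy K5[of x "\<sim> y"] by (simp add: imp_closed neg_neg)
  qed
  moreover have "map_of_arrow (beta T) \<zero> = \<zero>\<^bsub>K_obj (C_obj T)\<^esub>"
    "map_of_arrow (beta T) \<one> = \<one>\<^bsub>K_obj (C_obj T)\<^esub>"
    "map_of_arrow (beta T) \<cc> = \<cc>\<^bsub>K_obj (C_obj T)\<^esub>"
    by (simp_all add: neg_one neg_zero)
  moreover have "map_of_arrow (beta T) (\<sim> x) = \<sim>\<^bsub>K_obj (C_obj T)\<^esub> (map_of_arrow (beta T) x)"
    if "x \<in> carrier T" for x
    using that by (simp add: neg_neg)
  ultimately show ?thesis
    by (simp add: khil_hom_def hil_hom_def bdl_hom_def)
qed

lemma inj_on_beta: "inj_on (map_of_arrow (beta T)) (carrier T)"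
proof (rule inj_onI)
  fix x y assume xy: "x \<in> carrier T" "y \<in> carrier T"
    and eq: "map_of_arrow (beta T) x = map_of_arrow (beta T) y"
  have "x \<sqinter> \<cc> = \<sim> ((\<sim> x) \<squnion> \<cc>)"
    using xy by (simp add: neg_join neg_neg)
  also have "\<dots> = \<sim> ((\<sim> y) \<squnion> \<cc>)"
    using xy eq by simp
  also have "\<dots> = y \<sqinter> \<cc>"
    using xy by (simp add: neg_join neg_neg)
  finally show "x = y"
    using xy eq by (intro eq_from_meet_join[of x y \<cc>]) auto
qed

lemma beta_bij:
  assumes "CK T"
  shows "bij_betw (map_of_arrow (beta T)) (carrier T) (carrier (K_obj (C_obj T)))"
  unfolding bij_betw_def
proof (intro conjI inj_on_beta subset_antisym subsetI)
  fix p assume "p \<in> map_of_arrow (beta T) ` carrier T"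
  then show "p \<in> carrier (K_obj (C_obj T))"
    by (auto simp: join_assoc join_center_meet_neg)
next
  fix p assume "p \<in> carrier (K_obj (C_obj T))"
  then obtain x y where p: "p = Pair x y" "x \<in> carrier (C_obj T)" "y \<in> carrier (C_obj T)"
      "x \<sqinter>\<^bsub>C_obj T\<^esub> y = \<zero>\<^bsub>C_obj T\<^esub>"
    by (rule K_obj_cases)
  \<comment> \<open>The bottom of \<open>C_obj T\<close> is \<open>\<cc>\<close>, so the
    disjointness of \<open>x\<close> and \<open>y\<close> is the premise
    \<open>x \<sqinter> y = \<cc>\<close> of (CK).\<close>
  then obtain z where "z \<in> carrier T" "z \<squnion> \<cc> = x" "(\<sim> z) \<squnion> \<cc> = y"
    using assms unfolding CK_def by (auto simp: C_obj_def)
  then show "p \<in> map_of_arrow (beta T) ` carrier T"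
    using p by (intro image_eqI[of _ _ z]) auto
qed

end

section \<open>The equivalence\<close>

lemma is_functor_K: "is_functor hBDL KhBDL_CK K_functor"
proof (rule is_functor.intro[OF category_hBDL category_KhBDL_CK], unfold_locales)
  fix X :: "'a univ hil" assume "X \<in> Obj hBDL"
  then interpret univ_hil X by (auto simp: hBDL_def intro: univ_hil.intro)
  show "on_obj K_functor X \<in> Obj KhBDL_CK"
    by (simp add: KhBDL_CK_eq K_functor_def khbdl_algebra_K_obj CK_K_obj)
  show "on_arr K_functor (Id hBDL X) = Id KhBDL_CK (on_obj K_functor X)"
    by (auto simp: hBDL_def KhBDL_CK_eq K_functor_def K_arr_def fun_eq_iff elim!: K_obj_cases)
next
  fix f and X Y :: "'a univ hil" assume "f \<in> Hom hBDL X Y"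
  then show "on_arr K_functor f \<in> Hom KhBDL_CK (on_obj K_functor X) (on_obj K_functor Y)"
    by (auto simp: hBDL_def KhBDL_CK_eq K_functor_def K_arr_def K_map_hom
      intro: univ_hil.khbdl_algebra_K_obj univ_hil.CK_K_obj univ_hil.intro)
next
  fix f g and X Y Z :: "'a univ hil" assume *: "f \<in> Hom hBDL X Y" "g \<in> Hom hBDL Y Z"
  then have f: "(\<lambda>x \<in> carrier (K_obj X). Pair (map_of_arrow f (pfst x)) (map_of_arrow f (psnd x)))
      \<in> carrier (K_obj X) \<rightarrow>\<^sub>E carrier (K_obj Y)"
    using K_map_hom[of "map_of_arrow f" X Y]
    by (auto simp: hBDL_def khil_hom_def hil_hom_def bdl_hom_def)
  \<comment> \<open>The outer arrow is restricted to \<open>carrier (K_obj Y)\<close>, so the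
    composite can be evaluated only once this membership is known.\<close>
  have "Pair (map_of_arrow f a) (map_of_arrow f b) \<in> carrier (K_obj Y)"
    if "Pair a b \<in> carrier (K_obj X)" for a b
    using PiE_mem[OF f that] that by (simp del: K_obj_simps(1))
  then show "on_arr K_functor (Comp hBDL g f) = Comp KhBDL_CK (on_arr K_functor g) (on_arr K_functor f)"
    using * by (auto simp: hBDL_def KhBDL_CK_eq K_functor_def K_arr_def compose_def fun_eq_iff
      elim!: K_obj_cases)
qed

lemma is_functor_C: "is_functor KhBDL_CK hBDL C_functor"
proof (rule is_functor.intro[OF category_KhBDL_CK category_hBDL], unfold_locales)
  fix X :: "'a khil" assume "X \<in> Obj KhBDL_CK"
  then interpret plain_khbdl X by (auto simp: KhBDL_CK_eq intro: plain_khbdl.intro)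
  show "on_obj C_functor X \<in> Obj hBDL"
    by (simp add: hBDL_def C_functor_def hemi_implicative_lattice_C_obj)
  show "on_arr C_functor (Id KhBDL_CK X) = Id hBDL (on_obj C_functor X)"
    by (auto simp: hBDL_def KhBDL_CK_eq C_functor_def C_arr_def fun_eq_iff)
next
  fix f and X Y :: "'a khil" assume "f \<in> Hom KhBDL_CK X Y"
  then show "on_arr C_functor f \<in> Hom hBDL (on_obj C_functor X) (on_obj C_functor Y)"
    by (auto simp: hBDL_def KhBDL_CK_eq C_functor_def C_arr_def C_map_hom
      intro: plain_khbdl.hemi_implicative_lattice_C_obj plain_khbdl.intro)
next
  fix f g and X Y Z :: "'a khil" assume *: "f \<in> Hom KhBDL_CK X Y" "g \<in> Hom KhBDL_CK Y Z"
  then have f: "restrict (map_of_arrow f) (carrier (C_obj X)) \<in> carrier (C_obj X) \<rightarrow>\<^sub>E carrier (C_obj Y)"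
    using C_map_hom[of "map_of_arrow f" X Y]
    by (auto simp: KhBDL_CK_eq hil_hom_def bdl_hom_def)
  have "map_of_arrow f x \<in> carrier (C_obj Y)" if "x \<in> carrier (C_obj X)" for x
    using PiE_mem[OF f that] that by simp
  \<comment> \<open>The composite in \<open>KhBDL_CK\<close> is cut off to \<open>carrier X\<close>,
    the one in \<open>hBDL\<close> to \<open>carrier (C_obj X)\<close>; the inclusion reconciles the
    two restrictions.\<close>
  moreover have "carrier (C_obj X) \<subseteq> carrier X"
    by (auto simp: C_obj_def)
  ultimately show "on_arr C_functor (Comp KhBDL_CK g f) = Comp hBDL (on_arr C_functor g) (on_arr C_functor f)"
    using * by (auto simp: hBDL_def KhBDL_CK_eq C_functor_def C_arr_def compose_def fun_eq_iff)
qed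

section \<open>Identity and composite functors, and the two natural isomorphisms\<close>

lemma is_functor_id: "category A \<Longrightarrow> is_functor A A id_functor"
  by (auto simp: is_functor_def is_functor_axioms_def id_functor_def)

lemma is_functor_comp:
  assumes "is_functor A B F" "is_functor B D G"
  shows "is_functor A D (comp_functor G F)"
proof -
  interpret F: is_functor A B F by fact
  interpret G: is_functor B D G by fact
  show ?thesis
    by unfold_locales
      (auto simp: comp_functor_def F.on_obj_in G.on_obj_in F.on_arr_Id G.on_arr_Id
        intro: F.on_arr_in G.on_arr_in simp: F.on_arr_Comp G.on_arr_Comp[OF F.on_arr_in F.on_arr_in])
qed

lemma natural_isomorphism_alpha:
  "natural_isomorphism hBDL hBDL id_functor (comp_functor C_functor K_functor) alpha"
proof (intro natural_isomorphism.intro natural_transformation.intro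
    natural_transformation_axioms.intro natural_isomorphism_axioms.intro)
  show "is_functor hBDL hBDL id_functor"
    by (intro is_functor_id category_hBDL)
  show "is_functor hBDL hBDL (comp_functor C_functor K_functor)"
    by (rule is_functor_comp[OF is_functor_K is_functor_C])
next
  fix X :: "'a univ hil" assume "X \<in> Obj hBDL"
  then interpret univ_hil X by (auto simp: hBDL_def intro: univ_hil.intro)
  interpret K: plain_khbdl "K_obj X" by (intro plain_khbdl.intro khbdl_algebra_K_obj)
  interpret CK: hemi_implicative_lattice "C_obj (K_obj X)" by (rule K.hemi_implicative_lattice_C_obj)
  have comp: "alpha X \<in> Hom hBDL X (C_obj (K_obj X))"
    using alpha_hom hemi_implicative_lattice_axioms CK.hemi_implicative_lattice_axioms
    by (simp add: hBDL_def) (simp add: alpha_def)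
  then show "alpha X \<in> Hom hBDL (on_obj id_functor X) (on_obj (comp_functor C_functor K_functor) X)"
    by (simp add: id_functor_def comp_functor_def C_functor_def K_functor_def)
  show "is_iso hBDL (alpha X)"
    unfolding hBDL_def
  proof (rule is_iso_algebra_category)
    show "alpha X \<in> Hom (algebra_category {H. hemi_implicative_lattice H} hil_hom) X (C_obj (K_obj X))"
      using comp by (simp add: hBDL_def)
    show "(\<lambda>y \<in> carrier (C_obj (K_obj X)). inv_into (carrier X) (map_of_arrow (alpha X)) y)
        \<in> hil_hom (C_obj (K_obj X)) X"
      by (rule inv_hil_hom[OF alpha_hom alpha_bij bounded_distributive_lattice_axioms
        CK.bounded_distributive_lattice_axioms imp_closed CK.imp_closed])
  qed (rule alpha_bij)
next
  fix f and X Y :: "'a univ hil" assume f: "f \<in> Hom hBDL X Y"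
  then interpret univ_hil X by (auto simp: hBDL_def intro: univ_hil.intro)
  \<comment> \<open>Both sides send \<open>a\<close> to the pair of the image of \<open>a\<close>
    and the bottom of \<open>Y\<close>, since the homomorphism preserves the bottom.\<close>
  show "Comp hBDL (alpha Y) (on_arr id_functor f) =
      Comp hBDL (on_arr (comp_functor C_functor K_functor) f) (alpha X)"
    using f carrier_C_K
    by (auto simp: hBDL_def id_functor_def comp_functor_def C_functor_def K_functor_def C_arr_def
      K_arr_def alpha_def compose_def hil_hom_def bdl_hom_def fun_eq_iff)
qed

lemma natural_isomorphism_beta:
  "natural_isomorphism KhBDL_CK KhBDL_CK id_functor (comp_functor K_functor C_functor) beta"
proof (intro natural_isomorphism.intro natural_transformation.intro
    natural_transformation_axioms.intro natural_isomorphism_axioms.intro)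
  show "is_functor KhBDL_CK KhBDL_CK id_functor"
    by (intro is_functor_id category_KhBDL_CK)
  show "is_functor KhBDL_CK KhBDL_CK (comp_functor K_functor C_functor)"
    by (rule is_functor_comp[OF is_functor_C is_functor_K])
next
  fix X :: "'a univ khil" assume X: "X \<in> Obj KhBDL_CK"
  then interpret univ_khbdl X by (auto simp: KhBDL_CK_eq intro: univ_khbdl.intro plain_khbdl.intro)
  interpret C: univ_hil "C_obj X" by (intro univ_hil.intro hemi_implicative_lattice_C_obj)
  have comp: "beta X \<in> Hom KhBDL_CK X (K_obj (C_obj X))"
    using beta_hom X C.khbdl_algebra_K_obj C.CK_K_obj
    by (simp add: KhBDL_CK_eq) (simp add: beta_def)
  then show "beta X \<in> Hom KhBDL_CK (on_obj id_functor X) (on_obj (comp_functor K_functor C_functor) X)"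
    by (simp add: id_functor_def comp_functor_def C_functor_def K_functor_def)
  have bij: "bij_betw (map_of_arrow (beta X)) (carrier X) (carrier (K_obj (C_obj X)))"
    using X by (intro beta_bij) (simp add: KhBDL_CK_eq)
  show "is_iso KhBDL_CK (beta X)"
    unfolding KhBDL_CK_eq
  proof (rule is_iso_algebra_category)
    show "beta X \<in> Hom (algebra_category {T. khbdl_algebra T \<and> CK T} khil_hom) X (K_obj (C_obj X))"
      using comp by (simp add: KhBDL_CK_eq)
    show "(\<lambda>y \<in> carrier (K_obj (C_obj X)). inv_into (carrier X) (map_of_arrow (beta X)) y)
        \<in> khil_hom (K_obj (C_obj X)) X"
      by (rule inv_khil_hom[OF beta_hom bij khbdl_algebra_axioms C.khbdl_algebra_K_obj])
  qed (rule bij)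
next
  fix f and X Y :: "'a univ khil" assume f: "f \<in> Hom KhBDL_CK X Y"
  then interpret univ_khbdl X by (auto simp: KhBDL_CK_eq intro: univ_khbdl.intro plain_khbdl.intro)
  \<comment> \<open>The homomorphism commutes with join, negation and the center, so both sides
    agree on \<open>x\<close>. The last two rewrite rules show that the pair assigned to
    \<open>x\<close> lies where the restricted map on pairs is defined.\<close>
  show "Comp KhBDL_CK (beta Y) (on_arr id_functor f) =
      Comp KhBDL_CK (on_arr (comp_functor K_functor C_functor) f) (beta X)"
    using f
    by (auto simp: KhBDL_CK_eq id_functor_def comp_functor_def C_functor_def K_functor_def C_arr_def
      K_arr_def beta_def compose_def khil_hom_def hil_hom_def bdl_hom_def fun_eq_iff
      join_assoc join_center_meet_neg)
qed

theorem theorem49: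
  "categorical_equivalence
     (hBDL :: ('a univ hil, ('a univ hil, 'a univ) arrow) cat) KhBDL_CK
     K_functor C_functor alpha beta"
  by (intro categorical_equivalence.intro is_functor_K is_functor_C
    natural_isomorphism_alpha natural_isomorphism_beta)

end
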